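(* Let $F$ be a (finite) confluence, let $t\in F$ and $x,y\in F^t$. 1. The join $x\vee_t y$ of $x$ and $y$ in the lattice $F^t$ is the least element of $F^x\cap F^y$ (and is therefore denoted $x\vee_F y$). 2. If $t'\in F$ and $t'\ge t$, then $F^{t'}$ is a sublattice of $F^t$; i.e. $\wedge_{t'}=\wedge_t$ on $F^{t'}$.
   Context: All ordered sets are finite. For an ordered set $E$ and $t\in E$, $E^t=\{x\in E : x\ge t\}$. A (finite) ordered set $F$ is a confluence if for every $t\in F$ the set $F^t$ (with the induced order) is a meet-semilattice with a greatest element; by finiteness, $F^t$ is then a lattice, whose meet and join are written $\wedge_t$ and $\vee_t$. *)

theory Defs
  imports "HOL-Algebra.Lattice"
begin

definition upper_part :: "('a, 'b) gorder_scheme \<Rightarrow> 'a \<Rightarrow> ('a, 'b) gorder_scheme"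
    (\<open>(_\<up>_)\<close> [1000, 1000] 999)
  where "F\<up>t = F\<lparr>carrier := {x \<in> carrier F. t \<sqsubseteq>\<^bsub>F\<^esub> x}\<rparr>"

locale confluence = partial_order F for F (structure) +
  assumes finite_carrier: "finite (carrier F)"
    and upper_part_lower_semilattice: "t \<in> carrier F \<Longrightarrow> lower_semilattice (F\<up>t)"
    and upper_part_top: "t \<in> carrier F \<Longrightarrow> \<exists>g. greatest (F\<up>t) g (carrier (F\<up>t))"

text \<open>Closure of \<^term>\<open>carrier K\<close> under the operations of \<^term>\<open>L\<close> is implied:
  they agree on \<^term>\<open>carrier K\<close> with the operations of \<^term>\<open>K\<close>, which is itself a lattice.
  Agreement of the operations also makes the order of \<^term>\<open>K\<close> the one induced from \<^term>\<open>L\<close>.\<close>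

definition sublattice :: "('a, 'b) gorder_scheme \<Rightarrow> ('a, 'c) gorder_scheme \<Rightarrow> bool"
  where "sublattice K L \<longleftrightarrow>
    lattice K \<and> lattice L \<and> carrier K \<subseteq> carrier L \<and>
    (\<forall>x \<in> carrier K. \<forall>y \<in> carrier K.
      x \<squnion>\<^bsub>K\<^esub> y = x \<squnion>\<^bsub>L\<^esub> y \<and> x \<sqinter>\<^bsub>K\<^esub> y = x \<sqinter>\<^bsub>L\<^esub> y)"

text \<open>The library's \<^const>\<open>join\<close> and \<^const>\<open>meet\<close> are defined by a choice operator; the following
  lemma ensures that on \<^term>\<open>F\<up>t\<close> they are the actual lattice operations.\<close>

lemma (in confluence) upper_part_lattice:
  assumes t: "t \<in> carrier F"
  shows "lattice (F\<up>t)"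
proof -
  let ?L = "F\<up>t"
  interpret L: lower_semilattice ?L
    by (rule upper_part_lower_semilattice[OF t])
  obtain g where g: "greatest ?L g (carrier ?L)"
    using upper_part_top[OF t] by blast
  have fin: "finite (carrier ?L)"
    using finite_carrier by (simp add: upper_part_def)
  have "\<exists>s. least ?L s (Upper ?L {x, y})" if x: "x \<in> carrier ?L" and y: "y \<in> carrier ?L" for x y
  proof -
    let ?U = "Upper ?L {x, y}"
    have U: "?U \<subseteq> carrier ?L" "g \<in> ?U"
      using g x y by (auto simp: Upper_def greatest_def)
    have "greatest ?L (Lattice.inf ?L ?U) (Lower ?L ?U)"
      using U finite_subset[OF U(1) fin] by (intro L.weak.finite_inf_greatest) auto
    then have "least ?L (Lattice.inf ?L ?U) ?U"
      using x y by (auto simp: least_def greatest_def Lower_def Upper_def)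
    then show ?thesis ..
  qed
  then show ?thesis
    by unfold_locales auto
qed

end

theory Submission
  imports Defs
begin

lemma mem_upper_part_iff [simp]: "x \<in> carrier (F\<up>t) \<longleftrightarrow> x \<in> carrier F \<and> t \<sqsubseteq>\<^bsub>F\<^esub> x"
  by (simp add: upper_part_def)

lemma le_upper_part [simp]: "le (F\<up>t) = le F"
  by (simp add: upper_part_def)

text \<open>\<open>least\<close> consults the carrier only to require that \<open>A\<close> lie
  inside it. Leastness can therefore be moved from any \<open>F\<up>t\<close> to the single order
  \<open>F\<close>, where joins taken over different base points become comparable.\<close>

lemma least_upper_part_iff:
  "least (F\<up>t) s A \<longleftrightarrow> least F s A \<and> A \<subseteq> carrier (F\<up>t)"
  by (auto simp: least_def)

text \<open>Anything above \<open>x\<close> is above \<open>t\<close> by transitivity, so the base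
  point imposes no further condition on common upper bounds.\<close>

lemma (in partial_order) Upper_upper_part_pair:
  assumes "t \<in> carrier L" "x \<in> carrier (L\<up>t)" "y \<in> carrier (L\<up>t)"
  shows "Upper (L\<up>t) {x, y} = carrier (L\<up>x) \<inter> carrier (L\<up>y)"
  using assms by (auto simp: Upper_def intro: le_trans)

context confluence
begin

lemma least_upper_part_join:
  assumes "t \<in> carrier F" "x \<in> carrier (F\<up>t)" "y \<in> carrier (F\<up>t)"
  shows "least F (x \<squnion>\<^bsub>F\<up>t\<^esub> y) (carrier (F\<up>x) \<inter> carrier (F\<up>y))"
proof -
  interpret T: lattice "F\<up>t" by (rule upper_part_lattice[OF assms(1)])
  have "least (F\<up>t) (x \<squnion>\<^bsub>F\<up>t\<^esub> y) (Upper (F\<up>t) {x, y})"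
    unfolding join_def using assms(2,3) by (rule T.sup_of_two_least)
  then show ?thesis
    by (simp add: Upper_upper_part_pair[OF assms] least_upper_part_iff)
qed

lemma carrier_upper_part_mono:
  assumes "t \<in> carrier F" "t' \<in> carrier F" "t \<sqsubseteq> t'"
  shows "carrier (F\<up>t') \<subseteq> carrier (F\<up>t)"
  using assms by (auto intro: le_trans)

text \<open>Both joins are least elements in \<open>F\<close> of one and the same set, whose
  description mentions neither \<open>t\<close> nor \<open>t'\<close>; antisymmetry of
  \<open>F\<close> then identifies them.\<close>

lemma upper_part_join_eq:
  assumes "t \<in> carrier F" "t' \<in> carrier F" "t \<sqsubseteq> t'"
    and "u \<in> carrier (F\<up>t')" "v \<in> carrier (F\<up>t')"
  shows "u \<squnion>\<^bsub>F\<up>t'\<^esub> v = u \<squnion>\<^bsub>F\<up>t\<^esub> v"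
proof (rule least_unique)
  show "least F (u \<squnion>\<^bsub>F\<up>t'\<^esub> v) (carrier (F\<up>u) \<inter> carrier (F\<up>v))"
    using assms by (intro least_upper_part_join)
  show "least F (u \<squnion>\<^bsub>F\<up>t\<^esub> v) (carrier (F\<up>u) \<inter> carrier (F\<up>v))"
    using assms carrier_upper_part_mono[OF assms(1-3)] by (intro least_upper_part_join) blast+
qed

text \<open>As \<^term>\<open>t'\<close> is itself a lower bound of \<^term>\<open>u\<close> and \<^term>\<open>v\<close> in \<^term>\<open>F\<up>t\<close>, their meet there
  lies above \<^term>\<open>t'\<close>.\<close>

lemma upper_part_meet_eq:
  assumes t: "t \<in> carrier F" and t': "t' \<in> carrier F" "t \<sqsubseteq> t'"
    and uv: "u \<in> carrier (F\<up>t')" "v \<in> carrier (F\<up>t')"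
  shows "u \<sqinter>\<^bsub>F\<up>t'\<^esub> v = u \<sqinter>\<^bsub>F\<up>t\<^esub> v"
proof -
  interpret T: lattice "F\<up>t" by (rule upper_part_lattice[OF t])
  interpret T': lattice "F\<up>t'" by (rule upper_part_lattice[OF t'(1)])
  have sub: "carrier (F\<up>t') \<subseteq> carrier (F\<up>t)"
    by (rule carrier_upper_part_mono[OF t t'])
  then have uv_t: "u \<in> carrier (F\<up>t)" "v \<in> carrier (F\<up>t)"
    using uv by blast+
  have gt: "greatest (F\<up>t) (u \<sqinter>\<^bsub>F\<up>t\<^esub> v) (Lower (F\<up>t) {u, v})"
    unfolding meet_def using uv_t by (rule T.inf_of_two_greatest)
  have gt': "greatest (F\<up>t') (u \<sqinter>\<^bsub>F\<up>t'\<^esub> v) (Lower (F\<up>t') {u, v})"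
    unfolding meet_def using uv by (rule T'.inf_of_two_greatest)
  \<comment> \<open>Unlike upper bounds, lower bounds do depend on the base point.
    \<open>Lower\<close> tests only against those members of \<open>{u, v}\<close> that lie in the
    carrier, so membership in both carriers is supplied.\<close>
  have Lower_eq: "Lower (F\<up>t') {u, v} = Lower (F\<up>t) {u, v} \<inter> carrier (F\<up>t')"
    using sub uv uv_t by (auto simp: Lower_def)
  have "t' \<in> Lower (F\<up>t) {u, v}"
    using t' uv by (auto simp: Lower_def)
  with gt have "t' \<sqsubseteq> u \<sqinter>\<^bsub>F\<up>t\<^esub> v"
    by (auto simp: greatest_def)
  \<comment> \<open>The meet taken in \<open>F\<up>t\<close> dominates the larger set of lower
    bounds and, being above \<open>t'\<close>, belongs to the smaller one; hence it is greatest
    there too.\<close>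
  with gt have "greatest (F\<up>t') (u \<sqinter>\<^bsub>F\<up>t\<^esub> v) (Lower (F\<up>t') {u, v})"
    unfolding Lower_eq by (auto simp: greatest_def Lower_def)
  with gt' show ?thesis by (rule T'.greatest_unique)
qed

lemma sublattice_upper_part:
  assumes "t \<in> carrier F" "t' \<in> carrier F" "t \<sqsubseteq> t'"
  shows "sublattice (F\<up>t') (F\<up>t)"
  unfolding sublattice_def
  using assms upper_part_lattice carrier_upper_part_mono upper_part_join_eq upper_part_meet_eq
  by blast

end

theorem lemma1:
  fixes F :: "('a, 'b) gorder_scheme" and t x y :: 'a
  assumes "confluence F" and "t \<in> carrier F"
    and "x \<in> carrier (F\<up>t)" and "y \<in> carrier (F\<up>t)"
  shows "least F (x \<squnion>\<^bsub>F\<up>t\<^esub> y) (carrier (F\<up>x) \<inter> carrier (F\<up>y)) \<and>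
    (\<forall>t' \<in> carrier F. t \<sqsubseteq>\<^bsub>F\<^esub> t' \<longrightarrow>
      sublattice (F\<up>t') (F\<up>t) \<and>
      (\<forall>u \<in> carrier (F\<up>t'). \<forall>v \<in> carrier (F\<up>t'). u \<sqinter>\<^bsub>F\<up>t'\<^esub> v = u \<sqinter>\<^bsub>F\<up>t\<^esub> v))"
proof -
  interpret confluence F by fact
  show ?thesis
    using assms least_upper_part_join sublattice_upper_part upper_part_meet_eq by blast
qed

end
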